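(* Suppose $d$ is a positive even integer. Then there exists a set of $d-1$ mutually quasi-unbiased weighing matrices for parameters $(d,2,4,1)$.
   Context: A weighing matrix of order $d$ and weight $k$ is a $d\times d$ matrix $W$ with entries in $\{0,\pm1\}$ with $WW^T=kI$. Two weighing matrices $W_1,W_2$ of order $d$ and weight $k$ are quasi-unbiased for parameters $(d,k,l,a)$ if $\frac{1}{\sqrt a}W_1W_2^T$ is a weighing matrix of weight $l$. A set is mutually quasi-unbiased for $(d,k,l,a)$ if any two distinct members are quasi-unbiased for $(d,k,l,a)$. *)

theory Defs
  imports Complex_Main "Jordan_Normal_Form.Matrix"
begin

definition weighing_matrix :: "nat \<Rightarrow> nat \<Rightarrow> real mat \<Rightarrow> bool" where
  "weighing_matrix d k W \<longleftrightarrow>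
     W \<in> carrier_mat d d \<and> elements_mat W \<subseteq> {- 1, 0, 1} \<and>
     W * transpose_mat W = real k \<cdot>\<^sub>m 1\<^sub>m d"

(* The condition 0 < a is implicit in the factor 1 / sqrt a; in HOL, 1 / sqrt 0 would be 0. *)
definition quasi_unbiased ::
  "nat \<Rightarrow> nat \<Rightarrow> nat \<Rightarrow> nat \<Rightarrow> real mat \<Rightarrow> real mat \<Rightarrow> bool" where
  "quasi_unbiased d k l a W\<^sub>1 W\<^sub>2 \<longleftrightarrow>
     weighing_matrix d k W\<^sub>1 \<and> weighing_matrix d k W\<^sub>2 \<and> 0 < a \<and>
     weighing_matrix d l ((1 / sqrt (real a)) \<cdot>\<^sub>m (W\<^sub>1 * transpose_mat W\<^sub>2))"

(* Membership of weighing matrices is stated separately, since the pairwise condition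
   says nothing about a set with a single element. *)
definition mutually_quasi_unbiased ::
  "nat \<Rightarrow> nat \<Rightarrow> nat \<Rightarrow> nat \<Rightarrow> real mat set \<Rightarrow> bool" where
  "mutually_quasi_unbiased d k l a S \<longleftrightarrow>
     (\<forall>W\<in>S. weighing_matrix d k W) \<and> pairwise (quasi_unbiased d k l a) S"

end

theory Submission
  imports Defs
begin

text \<open>
  A perfect matching of the \<open>d\<close> indices yields a symmetric weighing matrix of weight 2, with a
  block \<open>(1, 1; 1, -1)\<close> on every edge. If two matchings are edge-disjoint, then the supports of a
  row of the one matrix and a row of the other share at most one index, so the product has
  entries in \<open>{-1, 0, 1}\<close>; it has weight 4 because both factors are multiples of orthogonal
  matrices. The \<open>d - 1\<close> matchings of a 1-factorization of the complete graph on \<open>d\<close> vertices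
  therefore give the required set.
\<close>

definition perfect_matching :: "nat \<Rightarrow> (nat \<Rightarrow> nat) \<Rightarrow> bool" where
  "perfect_matching d m \<longleftrightarrow> (\<forall>i<d. m i < d \<and> m i \<noteq> i \<and> m (m i) = i)"

text \<open>What matters is that the two ends of an edge get opposite signs, which makes the two
  rows of its block orthogonal; comparing the ends is a canonical choice.\<close>

definition matching_sign :: "(nat \<Rightarrow> nat) \<Rightarrow> nat \<Rightarrow> real" where
  "matching_sign m i = (if i < m i then 1 else - 1)"

definition matching_mat :: "nat \<Rightarrow> (nat \<Rightarrow> nat) \<Rightarrow> real mat" where
  "matching_mat d m = mat d d (\<lambda>(i, j).
     if j = m i then 1 else if j = i then matching_sign m i else 0)"

lemma matching_mat_carrier [simp]:
  "matching_mat d m \<in> carrier_mat d d"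
  "dim_row (matching_mat d m) = d" "dim_col (matching_mat d m) = d"
  by (auto simp: matching_mat_def)

lemma matching_mat_index:
  assumes "i < d" "j < d"
  shows "matching_mat d m $$ (i, j) =
    (if j = m i then 1 else if j = i then matching_sign m i else 0)"
  using assms by (simp add: matching_mat_def)

lemma perfect_matchingD:
  assumes "perfect_matching d m" "i < d"
  shows "m i < d" "m i \<noteq> i" "m (m i) = i"
  using assms by (auto simp: perfect_matching_def)

lemma matching_sign_partner:
  assumes "perfect_matching d m" "i < d"
  shows "matching_sign m (m i) = - matching_sign m i"
  using perfect_matchingD[OF assms] by (auto simp: matching_sign_def)

lemma transpose_matching_mat:
  assumes "perfect_matching d m"
  shows "transpose_mat (matching_mat d m) = matching_mat d m"
proof (rule eq_matI)
  fix i j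
  assume "i < dim_row (matching_mat d m)" "j < dim_col (matching_mat d m)"
  then have "i < d" "j < d" by auto
  then show "transpose_mat (matching_mat d m) $$ (i, j) = matching_mat d m $$ (i, j)"
    using perfect_matchingD[OF assms \<open>i < d\<close>] perfect_matchingD[OF assms \<open>j < d\<close>]
    by (auto simp: matching_mat_index)
qed auto

text \<open>Row \<open>i\<close> of the matching matrix is supported on \<open>{i, m i}\<close>, so
  the scalar product collapses to two terms. \<open>B\<close> is arbitrary so that this serves both
  the square of one matching matrix and the product of two different ones.\<close>

lemma matching_mat_mult_transpose_index:
  assumes m: "perfect_matching d m" and B: "B \<in> carrier_mat d d" and ik: "i < d" "k < d"
  shows "(matching_mat d m * transpose_mat B) $$ (i, k) =
    matching_sign m i * B $$ (k, i) + B $$ (k, m i)"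
proof -
  note mi = perfect_matchingD[OF m \<open>i < d\<close>]
  have "(matching_mat d m * transpose_mat B) $$ (i, k) =
      (\<Sum>j\<in>{0..<d}. matching_mat d m $$ (i, j) * B $$ (k, j))"
    using B ik by (simp add: scalar_prod_def)
  also have "\<dots> = (\<Sum>j\<in>{i, m i}. matching_mat d m $$ (i, j) * B $$ (k, j))"
    using mi ik by (intro sum.mono_neutral_right) (auto simp: matching_mat_index)
  also have "\<dots> = matching_sign m i * B $$ (k, i) + B $$ (k, m i)"
    using mi ik by (simp add: matching_mat_index)
  finally show ?thesis .
qed

lemma elements_mat_subsetI:
  assumes "A \<in> carrier_mat n m" "\<And>i j. i < n \<Longrightarrow> j < m \<Longrightarrow> A $$ (i, j) \<in> X"
  shows "elements_mat A \<subseteq> X"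
  using assms by (auto simp: elements_mat_def)

lemma weighing_matching_mat:
  assumes m: "perfect_matching d m"
  shows "weighing_matrix d 2 (matching_mat d m)"
  unfolding weighing_matrix_def
proof (intro conjI)
  show "elements_mat (matching_mat d m) \<subseteq> {- 1, 0, 1}"
    by (rule elements_mat_subsetI[of _ d d]) (auto simp: matching_mat_index matching_sign_def)
  show "matching_mat d m * transpose_mat (matching_mat d m) = real 2 \<cdot>\<^sub>m 1\<^sub>m d"
  proof (rule eq_matI)
    fix i k
    assume "i < dim_row (real 2 \<cdot>\<^sub>m 1\<^sub>m d :: real mat)" "k < dim_col (real 2 \<cdot>\<^sub>m 1\<^sub>m d :: real mat)"
    then have ik: "i < d" "k < d" by auto
    note mi = perfect_matchingD[OF m \<open>i < d\<close>] and mk = perfect_matchingD[OF m \<open>k < d\<close>]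
    have entry: "(matching_mat d m * transpose_mat (matching_mat d m)) $$ (i, k) =
        matching_sign m i * matching_mat d m $$ (k, i) + matching_mat d m $$ (k, m i)"
      by (rule matching_mat_mult_transpose_index[OF m _ ik]) simp
    \<comment> \<open>The two terms are both 1, cancel by the opposite signs on an edge, or both
      vanish, respectively.\<close>
    consider "k = i" | "k = m i" | "k \<noteq> i" "k \<noteq> m i" by blast
    then show "(matching_mat d m * transpose_mat (matching_mat d m)) $$ (i, k) =
      (real 2 \<cdot>\<^sub>m 1\<^sub>m d) $$ (i, k)"
    proof cases
      case 1
      then show ?thesis
        unfolding entry using mi ik by (simp add: matching_mat_index) (simp add: matching_sign_def)
    next
      case 2
      then show ?thesis
        unfolding entry using mi ik matching_sign_partner[OF m \<open>i < d\<close>]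
        by (simp add: matching_mat_index)
    next
      case 3
      then have "i \<noteq> m k" "m i \<noteq> m k" using mi mk by metis+
      then show ?thesis
        unfolding entry using 3 mi ik by (simp add: matching_mat_index)
    qed
  qed auto
qed simp

lemma quasi_unbiased_matching_mats:
  assumes m: "perfect_matching d m" and m': "perfect_matching d m'"
    and disj: "\<And>i. i < d \<Longrightarrow> m i \<noteq> m' i"
  shows "quasi_unbiased d 2 4 1 (matching_mat d m) (matching_mat d m')"
proof -
  let ?A = "matching_mat d m" and ?B = "matching_mat d m'"
  let ?P = "?A * ?B"
  have carr: "?A \<in> carrier_mat d d" "?B \<in> carrier_mat d d" by auto
  note A = weighing_matching_mat[OF m, unfolded weighing_matrix_def transpose_matching_mat[OF m]]
  note B = weighing_matching_mat[OF m', unfolded weighing_matrix_def transpose_matching_mat[OF m']]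
  have entries: "?P $$ (i, k) \<in> {- 1, 0, 1}" if ik: "i < d" "k < d" for i k
  proof -
    note mi = perfect_matchingD[OF m \<open>i < d\<close>] and mk = perfect_matchingD[OF m' \<open>k < d\<close>]
    have "?P $$ (i, k) = matching_sign m i * ?B $$ (k, i) + ?B $$ (k, m i)"
      using matching_mat_mult_transpose_index[OF m carr(2) ik]
      by (simp add: transpose_matching_mat[OF m'])
    \<comment> \<open>If both were nonzero, the edge \<open>{i, m i}\<close> would equal the edge
      \<open>{k, m' k}\<close> of the other matching, giving \<open>m i = m' i\<close>.\<close>
    moreover have "?B $$ (k, i) = 0 \<or> ?B $$ (k, m i) = 0"
      using mi mk ik disj[of i] by (auto simp: matching_mat_index)
    moreover have "?B $$ (k, j) \<in> {- 1, 0, 1}" if "j < d" for j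
      using that ik by (simp add: matching_mat_index matching_sign_def)
    ultimately show ?thesis
      using mi(1) ik(1) by (force simp: matching_sign_def)
  qed
  have "?P * transpose_mat ?P = ?A * ?B * (?B * ?A)"
    by (simp add: transpose_mult[OF carr] transpose_matching_mat[OF m] transpose_matching_mat[OF m'])
  also have "\<dots> = ?A * ((?B * ?B) * ?A)"
    using assoc_mult_mat[OF carr mult_carrier_mat[OF carr(2,1)]]
      assoc_mult_mat[OF carr(2) carr(2) carr(1)]
    by simp
  also have "\<dots> = 2 \<cdot>\<^sub>m (?A * ?A)"
    using B by (simp add: mult_smult_distrib[of _ d d _ d] mult_smult_assoc_mat[of _ d d _ d])
  also have "\<dots> = real 4 \<cdot>\<^sub>m 1\<^sub>m d"
    using A by (auto intro!: eq_matI)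
  finally have prod: "?P * transpose_mat ?P = real 4 \<cdot>\<^sub>m 1\<^sub>m d" .
  have "1 / sqrt (real 1) \<cdot>\<^sub>m (?A * transpose_mat ?B) = ?P"
    by (auto simp: transpose_matching_mat[OF m'])
  moreover have "weighing_matrix d 4 ?P"
    unfolding weighing_matrix_def
    using prod mult_carrier_mat[OF carr] elements_mat_subsetI[OF mult_carrier_mat[OF carr] entries]
    by blast
  ultimately show ?thesis
    using weighing_matching_mat[OF m] weighing_matching_mat[OF m']
    by (simp add: quasi_unbiased_def)
qed

text \<open>
  The round-robin 1-factorization of the complete graph on \<open>{0..n}\<close>, for odd \<open>n\<close>: vertices
  \<open>i \<noteq> j\<close> below \<open>n\<close> meet in round \<open>c \<equiv> i + j\<close> modulo \<open>n\<close>, and vertex \<open>n\<close> meets the solution \<open>i\<close>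
  of \<open>2 i \<equiv> c\<close>.
\<close>
definition round_robin :: "nat \<Rightarrow> nat \<Rightarrow> nat \<Rightarrow> nat" where
  "round_robin n c i =
    (if i = n then (if even c then c div 2 else (c + n) div 2)
     else if 2 * i = c \<or> 2 * i = c + n then n
     else if i \<le> c then c - i else c + n - i)"

text \<open>Modulo \<open>n\<close>, the map from \<open>i\<close> to \<open>c - i\<close> is an
  involution. As \<open>n\<close> is odd, its only fixed point is the solution of
  \<open>2 * i = c\<close> modulo \<open>n\<close>, and this point is paired with the extra vertex
  \<open>n\<close>.\<close>

lemma perfect_matching_round_robin:
  assumes "odd n" "c < n"
  shows "perfect_matching (Suc n) (round_robin n c)"
  unfolding perfect_matching_def
proof (intro allI impI)
  fix i
  assume i: "i < Suc n"
  show "round_robin n c i < Suc n \<and> round_robin n c i \<noteq> i \<and>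
    round_robin n c (round_robin n c i) = i"
  proof (cases "i = n")
    case True
    then show ?thesis
      using assms by (auto simp: round_robin_def elim!: evenE oddE)
  next
    case False
    with i have "i < n" by simp
    consider "2 * i = c" | "2 * i = c + n" | "2 * i \<noteq> c" "2 * i \<noteq> c + n" "i \<le> c"
      | "2 * i \<noteq> c" "2 * i \<noteq> c + n" "c < i"
      by linarith
    then show ?thesis
    proof cases
      case 1
      then show ?thesis
        using \<open>i < n\<close> by (auto simp: round_robin_def)
    next
      case 2
      \<comment> \<open>The parity of \<open>c\<close> decides which half, that of \<open>c\<close>
        or that of \<open>c + n\<close>, is an integer; so vertex \<open>n\<close> is sent back to
        \<open>i\<close>.\<close>
      then have "odd c" "(c + n) div 2 = i"
        using \<open>odd n\<close> by presburger+
      then show ?thesis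
        using 2 \<open>i < n\<close> by (simp add: round_robin_def)
    next
      case 3
      then have "round_robin n c i = c - i" "round_robin n c (c - i) = i"
        using \<open>i < n\<close> \<open>c < n\<close> by (auto simp: round_robin_def)
      then show ?thesis
        using 3 \<open>c < n\<close> by auto
    next
      case 4
      then have "round_robin n c i = c + n - i" "round_robin n c (c + n - i) = i"
        using \<open>i < n\<close> \<open>c < n\<close> by (auto simp: round_robin_def)
      then show ?thesis
        using 4 \<open>i < n\<close> by auto
    qed
  qed
qed

text \<open>An edge determines its round modulo \<open>n\<close>: as the sum of its ends if both are
  below \<open>n\<close>, and otherwise as twice the end other than \<open>n\<close>. Read
  contrapositively, distinct rounds are edge-disjoint.\<close>

lemma round_robin_inject:
  assumes "odd n" "c < n" "c' < n" "i < Suc n" "round_robin n c i = round_robin n c' i"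
  shows "c = c'"
proof (cases "i = n")
  case True
  then show ?thesis
    using assms by (auto simp: round_robin_def split: if_splits elim!: evenE oddE)
next
  case False
  then show ?thesis
    using assms by (auto simp: round_robin_def split: if_splits)
qed

lemma inj_on_matching_mat_round_robin:
  assumes "odd n"
  shows "inj_on (\<lambda>c. matching_mat (Suc n) (round_robin n c)) {..<n}"
proof (rule inj_onI)
  fix c c'
  assume c: "c \<in> {..<n}" "c' \<in> {..<n}"
    and eq: "matching_mat (Suc n) (round_robin n c) = matching_mat (Suc n) (round_robin n c')"
  \<comment> \<open>Row 0 reveals the partner of 0. The diagonal entry there is also 1, so
    \<open>?j\<close> must be known to differ from 0.\<close>
  let ?j = "round_robin n c 0"
  have j: "?j < Suc n" "?j \<noteq> 0"
    using perfect_matchingD[OF perfect_matching_round_robin[OF assms], of c 0] c by auto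
  have "matching_mat (Suc n) (round_robin n c') $$ (0, ?j) = 1"
    using j by (simp flip: eq add: matching_mat_index)
  then have "round_robin n c' 0 = ?j"
    using j by (simp add: matching_mat_index split: if_splits)
  then show "c = c'"
    using round_robin_inject[OF assms, of c c' 0] c by simp
qed

theorem theorem5p2:
  fixes d :: nat
  assumes "0 < d" and "even d"
  shows "\<exists>S. finite S \<and> card S = d - 1 \<and> mutually_quasi_unbiased d 2 4 1 S"
proof -
  obtain n where d: "d = Suc n" using assms(1) gr0_implies_Suc by blast
  with assms(2) have n: "odd n" by simp
  let ?W = "\<lambda>c. matching_mat d (round_robin n c)"
  have "quasi_unbiased d 2 4 1 (?W c) (?W c')" if "c < n" "c' < n" "c \<noteq> c'" for c c'
    using that quasi_unbiased_matching_mats perfect_matching_round_robin[OF n]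
      round_robin_inject[OF n] unfolding d by blast
  then have "mutually_quasi_unbiased d 2 4 1 (?W ` {..<n})"
    using weighing_matching_mat perfect_matching_round_robin[OF n]
    by (auto simp: mutually_quasi_unbiased_def pairwise_def d)
  moreover have "card (?W ` {..<n}) = d - 1"
    using card_image[OF inj_on_matching_mat_round_robin[OF n]] d by simp
  ultimately show ?thesis by blast
qed

end
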